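(* Let $\mathbb{Y}$ be a nonempty indexing set with geodesic metric spaces $\{\mathcal{C}(Y)\}_{Y\in\mathbb{Y}}$ and projections $\{\pi_Y\}_{Y\in\mathbb{Y}}$ satisfying the strong projection axioms with projection constant $\theta$, let $K\geq 4\theta$, and let $\mathcal{P}_K(\mathbb{Y})$ be the associated projection complex. Then there exists a subtree $\mathcal{T}\subseteq\mathcal{P}_K(\mathbb{Y})$ such that the inclusion map $\mathcal{T}\hookrightarrow\mathcal{P}_K(\mathbb{Y})$ is a quasiisometry.
   Context: Projections. $\mathbb{Y}$ is an indexing set; to each $Y\in\mathbb{Y}$ is associated a geodesic metric space $\mathcal{C}(Y)$ and a function (projection) $\pi_Y$ from $\mathbb{Y}\setminus\{Y\}$ to the non-empty subsets of $\mathcal{C}(Y)$. For $X,Z\in\mathbb{Y}\setminus\{Y\}$ (possibly equal) put $d_Y(X,Z)=\mathrm{diam}(\pi_Y(X)\cup\pi_Y(Z))$, the diameter being taken in $\mathcal{C}(Y)$. Strong projection axioms with projection constant $\theta\in[0,\infty)$: (P3) $\mathrm{diam}(\pi_Y(X))\leq\theta$ for all distinct $X,Y\in\mathbb{Y}$; (P4) if $X,Y,Z\in\mathbb{Y}$ are distinct and $d_Y(X,Z)>\theta$, then $d_X(Y,Z)\leq\theta$; (P5) for all $X,Z\in\mathbb{Y}$ the set $\{Y\in\mathbb{Y}\setminus\{X,Z\}: d_Y(X,Z)>\theta\}$ is finite; (P4') if $X,Y,Z\in\mathbb{Y}$ are distinct and $d_Y(X,Z)>\theta$, then $\pi_X(Y)=\pi_X(Z)$.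 Projection complex. For $X,Z\in\mathbb{Y}$ let $\mathbb{Y}_K(X,Z)=\{Y\in\mathbb{Y}\setminus\{X,Z\}: d_Y(X,Z)>K\}$. The projection complex $\mathcal{P}_K(\mathbb{Y})$ is the graph with vertex set $\mathbb{Y}$ and an edge between distinct vertices $X,Z$ whenever $\mathbb{Y}_K(X,Z)=\emptyset$. Connected graphs carry the path metric with edges of length $1$; the subtree $\mathcal{T}$ (a subgraph that is a tree) carries its own path metric. *)

theory Defs
  imports "HOL-Analysis.Analysis"
begin

section \<open>Geodesic metric spaces and projections\<close>

definition geodesic_space :: "'b metric \<Rightarrow> bool" where
  "geodesic_space m \<longleftrightarrow>
    (\<forall>x\<in>mspace m. \<forall>y\<in>mspace m. \<exists>g :: real \<Rightarrow> 'b.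
       g 0 = x \<and> g (mdist m x y) = y \<and> g ` {0..mdist m x y} \<subseteq> mspace m \<and>
       (\<forall>s\<in>{0..mdist m x y}. \<forall>t\<in>{0..mdist m x y}. mdist m (g s) (g t) = \<bar>s - t\<bar>))"

text \<open>Diameters are extended reals, so that unbounded sets have infinite diameter.\<close>

definition mdiam :: "'b metric \<Rightarrow> 'b set \<Rightarrow> ennreal" where
  "mdiam m A = (SUP x\<in>A. SUP y\<in>A. ennreal (mdist m x y))"

text \<open>
  The spaces \<open>C Y\<close> have carriers inside one ambient type \<open>'b\<close>; this is no restriction, since any
  family of spaces embeds in its disjoint union.  \<open>\<pi> Y X\<close> is the projection of \<open>X\<close> to \<open>C Y\<close>,
  meaningful for \<open>X \<noteq> Y\<close> only.
\<close>

definition proj_dist :: "('a \<Rightarrow> 'b metric) \<Rightarrow> ('a \<Rightarrow> 'a \<Rightarrow> 'b set) \<Rightarrow> 'a \<Rightarrow> 'a \<Rightarrow> 'a \<Rightarrow> ennreal" where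
  "proj_dist C \<pi> Y X Z = mdiam (C Y) (\<pi> Y X \<union> \<pi> Y Z)"

definition proj_far ::
    "'a set \<Rightarrow> ('a \<Rightarrow> 'b metric) \<Rightarrow> ('a \<Rightarrow> 'a \<Rightarrow> 'b set) \<Rightarrow> real \<Rightarrow> 'a \<Rightarrow> 'a \<Rightarrow> 'a set" where
  "proj_far \<Y> C \<pi> K X Z = {Y \<in> \<Y> - {X, Z}. proj_dist C \<pi> Y X Z > ennreal K}"

locale strong_projections =
  fixes \<Y> :: "'a set" and C :: "'a \<Rightarrow> 'b metric" and \<pi> :: "'a \<Rightarrow> 'a \<Rightarrow> 'b set" and \<theta> :: real
  assumes geodesic: "Y \<in> \<Y> \<Longrightarrow> geodesic_space (C Y)"
    and proj_nonempty: "\<lbrakk>Y \<in> \<Y>; X \<in> \<Y>; X \<noteq> Y\<rbrakk> \<Longrightarrow> \<pi> Y X \<noteq> {}"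
    and proj_subset: "\<lbrakk>Y \<in> \<Y>; X \<in> \<Y>; X \<noteq> Y\<rbrakk> \<Longrightarrow> \<pi> Y X \<subseteq> mspace (C Y)"
    and theta_nonneg: "\<theta> \<ge> 0"
    and P3: "\<lbrakk>X \<in> \<Y>; Y \<in> \<Y>; X \<noteq> Y\<rbrakk> \<Longrightarrow> mdiam (C Y) (\<pi> Y X) \<le> ennreal \<theta>"
    and P4: "\<lbrakk>X \<in> \<Y>; Y \<in> \<Y>; Z \<in> \<Y>; X \<noteq> Y; Y \<noteq> Z; X \<noteq> Z; proj_dist C \<pi> Y X Z > ennreal \<theta>\<rbrakk>
               \<Longrightarrow> proj_dist C \<pi> X Y Z \<le> ennreal \<theta>"
    and P5: "\<lbrakk>X \<in> \<Y>; Z \<in> \<Y>\<rbrakk> \<Longrightarrow> finite (proj_far \<Y> C \<pi> \<theta> X Z)"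
    and P4': "\<lbrakk>X \<in> \<Y>; Y \<in> \<Y>; Z \<in> \<Y>; X \<noteq> Y; Y \<noteq> Z; X \<noteq> Z; proj_dist C \<pi> Y X Z > ennreal \<theta>\<rbrakk>
               \<Longrightarrow> \<pi> X Y = \<pi> X Z"

section \<open>Graphs, trees and the projection complex\<close>

record 'a ugraph =
  verts :: "'a set"
  edges :: "'a set set"

definition wf_ugraph :: "'a ugraph \<Rightarrow> bool" where
  "wf_ugraph G \<longleftrightarrow> (\<forall>e\<in>edges G. \<exists>u\<in>verts G. \<exists>v\<in>verts G. u \<noteq> v \<and> e = {u, v})"

definition subgraph :: "'a ugraph \<Rightarrow> 'a ugraph \<Rightarrow> bool" where
  "subgraph H G \<longleftrightarrow> wf_ugraph H \<and> verts H \<subseteq> verts G \<and> edges H \<subseteq> edges G"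

definition walk :: "'a ugraph \<Rightarrow> 'a list \<Rightarrow> bool" where
  "walk G xs \<longleftrightarrow> xs \<noteq> [] \<and> set xs \<subseteq> verts G \<and> successively (\<lambda>u v. {u, v} \<in> edges G) xs"

definition connected_ugraph :: "'a ugraph \<Rightarrow> bool" where
  "connected_ugraph G \<longleftrightarrow>
    (\<forall>u\<in>verts G. \<forall>v\<in>verts G. \<exists>xs. walk G xs \<and> hd xs = u \<and> last xs = v)"

definition cycle :: "'a ugraph \<Rightarrow> 'a list \<Rightarrow> bool" where
  "cycle G xs \<longleftrightarrow> walk G xs \<and> distinct xs \<and> length xs \<ge> 3 \<and> {last xs, hd xs} \<in> edges G"

definition tree :: "'a ugraph \<Rightarrow> bool" where
  "tree G \<longleftrightarrow> wf_ugraph G \<and> verts G \<noteq> {} \<and> connected_ugraph G \<and> (\<nexists>xs. cycle G xs)"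

definition proj_complex ::
    "'a set \<Rightarrow> ('a \<Rightarrow> 'b metric) \<Rightarrow> ('a \<Rightarrow> 'a \<Rightarrow> 'b set) \<Rightarrow> real \<Rightarrow> 'a ugraph" where
  "proj_complex \<Y> C \<pi> K =
    \<lparr>verts = \<Y>, edges = {{X, Z} | X Z. X \<in> \<Y> \<and> Z \<in> \<Y> \<and> X \<noteq> Z \<and> proj_far \<Y> C \<pi> K X Z = {}}\<rparr>"

section \<open>Graphs as metric spaces\<close>

text \<open>
  Points of the geometric realization of a graph are given by barycentric coordinates: finitely
  supported functions on the vertices, supported in a vertex or an edge.  The realization of a
  subgraph is thereby literally a subset of the realization of the graph.
\<close>

definition cells :: "'a ugraph \<Rightarrow> 'a set set" where
  "cells G = {{v} | v. v \<in> verts G} \<union> edges G"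

definition cell_points :: "'a set \<Rightarrow> ('a \<Rightarrow> real) set" where
  "cell_points s = {p. (\<forall>x. p x \<ge> 0) \<and> (\<forall>x. x \<notin> s \<longrightarrow> p x = 0) \<and> (\<Sum>x\<in>s. p x) = 1}"

definition realization :: "'a ugraph \<Rightarrow> ('a \<Rightarrow> real) set" where
  "realization G = (\<Union>s\<in>cells G. cell_points s)"

text \<open>
  For two points \<open>p\<close>, \<open>q\<close> of one edge \<open>{u, v}\<close>, the distance in the edge, viewed as the unit
  interval, is \<open>\<bar>p u - q u\<bar> = \<bar>p v - q v\<bar>\<close>; the half-sum below is this number, written without
  reference to the edge.
\<close>

definition seg_length :: "('a \<Rightarrow> real) \<Rightarrow> ('a \<Rightarrow> real) \<Rightarrow> real" where
  "seg_length p q = (\<Sum>x | p x \<noteq> q x. \<bar>p x - q x\<bar>) / 2"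

text \<open>
  Piecewise linear paths, given by their break points; consecutive break points lie in a common
  cell.  The path metric is the infimum of their lengths.  It is meaningful for points that can
  be joined by such a path, in particular for all points of the realization of a connected graph.
\<close>

definition pl_path :: "'a ugraph \<Rightarrow> ('a \<Rightarrow> real) list \<Rightarrow> bool" where
  "pl_path G ps \<longleftrightarrow> ps \<noteq> [] \<and> set ps \<subseteq> realization G \<and>
    successively (\<lambda>p q. \<exists>s\<in>cells G. p \<in> cell_points s \<and> q \<in> cell_points s) ps"

definition pl_length :: "('a \<Rightarrow> real) list \<Rightarrow> real" where
  "pl_length ps = (\<Sum>i<length ps - 1. seg_length (ps ! i) (ps ! Suc i))"

definition path_metric :: "'a ugraph \<Rightarrow> ('a \<Rightarrow> real) \<Rightarrow> ('a \<Rightarrow> real) \<Rightarrow> real" where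
  "path_metric G p q = Inf {pl_length ps | ps. pl_path G ps \<and> hd ps = p \<and> last ps = q}"

definition quasi_isometry ::
    "'p set \<Rightarrow> ('p \<Rightarrow> 'p \<Rightarrow> real) \<Rightarrow> 'q set \<Rightarrow> ('q \<Rightarrow> 'q \<Rightarrow> real) \<Rightarrow> ('p \<Rightarrow> 'q) \<Rightarrow> bool" where
  "quasi_isometry M d N e f \<longleftrightarrow> f \<in> M \<rightarrow> N \<and>
    (\<exists>L A. L \<ge> 1 \<and> A \<ge> 0 \<and>
      (\<forall>x\<in>M. \<forall>y\<in>M. d x y / L - A \<le> e (f x) (f y) \<and> e (f x) (f y) \<le> L * d x y + A) \<and>
      (\<forall>z\<in>N. \<exists>x\<in>M. e (f x) z \<le> A))"

end

theory Submission
  imports Defs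
begin

text \<open>
  Choose a base point \<open>R\<close>.  Strong projections make \<open>W \<in> \<Y>\<^sub>K(R, X)\<close> a strict partial order on \<open>\<Y>\<close>, read
  as \<open>W\<close> lies between \<open>R\<close> and \<open>X\<close>, in which the predecessors of each \<open>X\<close> form a finite chain
  (\<open>far_base_trans\<close>, \<open>far_base_total\<close>).  Joining each \<open>X \<noteq> R\<close> to its last predecessor, or to \<open>R\<close> if there
  is none, therefore gives a rooted tree on all of \<open>\<Y>\<close>, and no projection separates a vertex from
  its parent, so the tree lies in the projection complex (\<open>far_parent_empty\<close>).  In particular the
  complex is connected.

  The tree metric dominates the metric of the complex, and every vertex lies in the tree; what is
  left is to bound the tree distance of two vertices \<open>X\<close>, \<open>Z\<close> that are adjacent in the complex.
  Suppose \<open>W1 < W2 < W3\<close> precede \<open>X\<close>, and none of them precedes or equals \<open>Z\<close>.  Since \<open>R\<close> and \<open>X\<close> are far apart in the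
  middle space \<open>C W2\<close>, the projection of \<open>Z\<close> to it is far from that of \<open>R\<close> or from that of \<open>X\<close>.  In the
  first case \<open>W1\<close> sees \<open>Z\<close> where it sees \<open>X\<close>, so \<open>W1\<close> separates \<open>R\<close> from \<open>Z\<close> and does precede \<open>Z\<close>; in the
  second case \<open>W3\<close> sees \<open>Z\<close> where it sees \<open>R\<close>, so \<open>W3\<close> separates \<open>Z\<close> from \<open>X\<close>, against adjacency
  (\<open>no_three_predecessors\<close>).  Hence three steps up from \<open>X\<close>, and likewise from \<open>Z\<close>, reach a common
  ancestor, and the tree distance of \<open>X\<close> and \<open>Z\<close> is at most 6.

  To pass from adjacent vertices to arbitrary points of the realizations without subdividing
  paths, take the tree distance from a fixed vertex as a function on vertices and extend it affinely
  over the edges of the complex.  The extension is 6-Lipschitz along every piecewise linear path, which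
  bounds tree distances by 6 times the distances in the complex, up to an additive constant
  (\<open>path_metric_subgraph_le\<close>).
\<close>

section \<open>Piecewise linear paths and the path metric\<close>

text \<open>
  The lengths of the piecewise linear paths from \<open>p\<close> to \<open>q\<close>, generated one segment at a time: paths can then be
  concatenated and estimated by rule induction, without indices into lists of break points.
\<close>

inductive pl_joined :: "'a ugraph \<Rightarrow> ('a \<Rightarrow> real) \<Rightarrow> ('a \<Rightarrow> real) \<Rightarrow> real \<Rightarrow> bool" for G where
  refl: "p \<in> realization G \<Longrightarrow> pl_joined G p p 0"
| step: "\<lbrakk>s \<in> cells G; p \<in> cell_points s; p' \<in> cell_points s; pl_joined G p' q l\<rbrakk>
    \<Longrightarrow> pl_joined G p q (seg_length p p' + l)"

lemma pl_length_Cons2: "pl_length (p # q # ps) = seg_length p q + pl_length (q # ps)"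
  by (simp add: pl_length_def sum.lessThan_Suc_shift del: sum.lessThan_Suc)

lemma pl_path_Cons2:
  "pl_path G (p # q # ps) \<longleftrightarrow>
    (\<exists>s\<in>cells G. p \<in> cell_points s \<and> q \<in> cell_points s) \<and> pl_path G (q # ps)"
  by (auto simp: pl_path_def realization_def)

lemma pl_joined_iff_pl_path:
  "pl_joined G p q l \<longleftrightarrow> (\<exists>ps. pl_path G ps \<and> hd ps = p \<and> last ps = q \<and> pl_length ps = l)"
proof
  assume "pl_joined G p q l"
  then show "\<exists>ps. pl_path G ps \<and> hd ps = p \<and> last ps = q \<and> pl_length ps = l"
  proof induction
    case (refl p)
    then show ?case by (intro exI[of _ "[p]"]) (simp add: pl_path_def pl_length_def)
  next
    case (step s p p' q l)
    then obtain ps where ps: "pl_path G ps" "hd ps = p'" "last ps = q" "pl_length ps = l" by blast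
    then obtain qs where "ps = p' # qs" by (cases ps) (auto simp: pl_path_def)
    with ps step.hyps show ?case
      by (intro exI[of _ "p # p' # qs"]) (auto simp: pl_path_Cons2 pl_length_Cons2)
  qed
next
  have "pl_path G ps \<Longrightarrow> pl_joined G (hd ps) (last ps) (pl_length ps)" for ps
  proof (induction ps rule: induct_list012)
    case 1
    then show ?case by (simp add: pl_path_def)
  next
    case (2 p)
    then show ?case by (simp add: pl_path_def pl_length_def pl_joined.refl)
  next
    case (3 p q ps)
    then show ?case by (auto simp: pl_path_Cons2 pl_length_Cons2 intro: pl_joined.step)
  qed
  then show "\<exists>ps. pl_path G ps \<and> hd ps = p \<and> last ps = q \<and> pl_length ps = l \<Longrightarrow> pl_joined G p q l"
    by blast
qed

lemma path_metric_eq_Inf: "path_metric G p q = Inf {l. pl_joined G p q l}"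
  unfolding path_metric_def pl_joined_iff_pl_path by (rule arg_cong[where f = Inf]) auto

lemma pl_joined_nonneg: "pl_joined G p q l \<Longrightarrow> 0 \<le> l"
  by (induction rule: pl_joined.induct) (auto simp: seg_length_def intro!: add_nonneg_nonneg sum_nonneg)

lemma pl_joined_trans:
  "pl_joined G p q l \<Longrightarrow> pl_joined G q r m \<Longrightarrow> pl_joined G p r (l + m)"
proof (induction rule: pl_joined.induct)
  case (step s p p' q l)
  then show ?case using pl_joined.step[of s G p p' r "l + m"] by (simp add: add.assoc)
qed simp

lemma pl_joined_mono:
  assumes "cells H \<subseteq> cells G" shows "pl_joined H p q l \<Longrightarrow> pl_joined G p q l"
proof (induction rule: pl_joined.induct)
  case (refl p)
  then have "p \<in> realization G" using assms unfolding realization_def by blast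
  then show ?case by (rule pl_joined.refl)
next
  case (step s p p' q l)
  with assms show ?case by (auto intro: pl_joined.step)
qed

lemma path_metric_le: "pl_joined G p q l \<Longrightarrow> path_metric G p q \<le> l"
  unfolding path_metric_eq_Inf
  by (rule cInf_lower) (auto intro!: bdd_belowI[of _ 0] pl_joined_nonneg)

lemma path_metric_greatest:
  assumes "pl_joined G p q l0" and "\<And>l. pl_joined G p q l \<Longrightarrow> c \<le> l"
  shows "c \<le> path_metric G p q"
  unfolding path_metric_eq_Inf using assms by (intro cInf_greatest) auto

text \<open>
  This mixed form of the triangle inequality, with a path length in place of the second distance, spares
  choosing almost shortest paths.
\<close>

lemma path_metric_triangle:
  assumes "pl_joined G p q l" and "pl_joined G q r m"
  shows "path_metric G p r \<le> path_metric G p q + m"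
proof -
  have "path_metric G p r - m \<le> path_metric G p q"
  proof (rule path_metric_greatest[OF assms(1)])
    fix l' assume "pl_joined G p q l'"
    then show "path_metric G p r - m \<le> l'"
      using path_metric_le[OF pl_joined_trans[OF _ assms(2)]] by fastforce
  qed
  then show ?thesis by simp
qed

lemma seg_length_cell:
  assumes "finite s" "p \<in> cell_points s" "q \<in> cell_points s"
  shows "seg_length p q = (\<Sum>x\<in>s. \<bar>p x - q x\<bar>) / 2"
proof -
  have "(\<Sum>x | p x \<noteq> q x. \<bar>p x - q x\<bar>) = (\<Sum>x\<in>s. \<bar>p x - q x\<bar>)"
    using assms by (intro sum.mono_neutral_left) (auto simp: cell_points_def, metis)
  then show ?thesis by (simp add: seg_length_def)
qed

text \<open>
  Both points have coordinate sum 1, so the coordinates differ by at most 2 in total.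
\<close>

lemma seg_length_le_1:
  assumes "finite s" "p \<in> cell_points s" "q \<in> cell_points s"
  shows "seg_length p q \<le> 1"
proof -
  have "\<bar>p x - q x\<bar> \<le> p x + q x" for x
    using assms(2,3) by (auto simp: cell_points_def abs_le_iff add_increasing add_increasing2)
  then have "(\<Sum>x\<in>s. \<bar>p x - q x\<bar>) \<le> (\<Sum>x\<in>s. p x + q x)"
    by (intro sum_mono)
  also have "\<dots> = 2" using assms(2,3) by (simp add: sum.distrib cell_points_def)
  finally show ?thesis by (simp add: seg_length_cell[OF assms])
qed

definition vertex_point :: "'a \<Rightarrow> 'a \<Rightarrow> real" where
  "vertex_point v = indicator {v}"

lemma vertex_point_in_cell: "finite s \<Longrightarrow> v \<in> s \<Longrightarrow> vertex_point v \<in> cell_points s"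
  by (auto simp: cell_points_def vertex_point_def indicator_def)

text \<open>
  A vertex is written as a degenerate edge, so that vertices and edges can be treated alike.
\<close>

lemma cell_cases:
  assumes "wf_ugraph G" "s \<in> cells G"
  obtains u v where "u \<in> verts G" "v \<in> verts G" "s = {u, v}" "u = v \<or> {u, v} \<in> edges G"
proof (cases "s \<in> edges G")
  case True
  then show ?thesis using assms(1) that unfolding wf_ugraph_def by metis
next
  case False
  then obtain v where "v \<in> verts G" "s = {v, v}" using assms(2) by (auto simp: cells_def)
  then show ?thesis using that by blast
qed

lemma pl_joined_cell:
  assumes "wf_ugraph G" "s \<in> cells G" "p \<in> cell_points s" "q \<in> cell_points s"
  shows "\<exists>l\<le>1. pl_joined G p q l"
proof -
  have "finite s" using cell_cases[OF assms(1,2)] by auto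
  moreover have "pl_joined G p q (seg_length p q + 0)"
    using assms by (intro pl_joined.step pl_joined.refl) (auto simp: realization_def)
  ultimately show ?thesis using seg_length_le_1[of s p q] assms by auto
qed

lemma walk_rev: "walk G xs \<Longrightarrow> walk G (rev xs)"
  by (simp add: walk_def successively_rev insert_commute)

lemma walk_append:
  assumes "walk G (xs @ [x])" "walk G (x # ys)" shows "walk G (xs @ x # ys)"
  using assms by (cases xs rule: rev_cases) (auto simp: walk_def successively_append_iff)

lemma pl_joined_walk:
  assumes G: "wf_ugraph G" and "walk G xs"
  shows "\<exists>l. pl_joined G (vertex_point (hd xs)) (vertex_point (last xs)) l"
  using assms(2)
proof (induction xs rule: induct_list012)
  case 1
  then show ?case by (simp add: walk_def)
next
  case (2 v)
  then have "{v} \<in> cells G" by (simp add: walk_def cells_def)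
  then show ?case using pl_joined_cell[OF G, of "{v}"] vertex_point_in_cell[of "{v}"] by auto
next
  case (3 u v xs)
  then have cell: "{u, v} \<in> cells G" and walk: "walk G (v # xs)"
    by (auto simp: walk_def cells_def)
  from cell obtain l where l: "pl_joined G (vertex_point u) (vertex_point v) l"
    using pl_joined_cell[OF G, of "{u, v}"] vertex_point_in_cell[of "{u, v}"] by blast
  from "3.IH"(2)[OF walk] obtain m where
    "pl_joined G (vertex_point v) (vertex_point (last (v # xs))) m" by auto
  from pl_joined_trans[OF l this] show ?case by auto
qed

section \<open>Spanning subgraphs that coarsely fill in all edges\<close>

definition affine_extension :: "('a \<Rightarrow> real) \<Rightarrow> ('a \<Rightarrow> real) \<Rightarrow> real" where
  "affine_extension f p = (\<Sum>x | p x \<noteq> 0. p x * f x)"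

lemma affine_extension_cell:
  assumes "finite s" "p \<in> cell_points s"
  shows "affine_extension f p = (\<Sum>x\<in>s. p x * f x)"
  unfolding affine_extension_def
  using assms by (intro sum.mono_neutral_left) (auto simp: cell_points_def)

lemma affine_extension_le:
  assumes "finite s" "p \<in> cell_points s" "\<And>x. x \<in> s \<Longrightarrow> f x \<le> c"
  shows "affine_extension f p \<le> c"
proof -
  have "(\<Sum>x\<in>s. p x * f x) \<le> (\<Sum>x\<in>s. p x * c)"
    using assms by (intro sum_mono mult_left_mono) (auto simp: cell_points_def)
  also have "\<dots> = c" using assms by (simp add: cell_points_def flip: sum_distrib_right)
  finally show ?thesis using assms by (simp add: affine_extension_cell)
qed

lemma affine_extension_ge:
  assumes "finite s" "p \<in> cell_points s" "\<And>x. x \<in> s \<Longrightarrow> c \<le> f x"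
  shows "c \<le> affine_extension f p"
proof -
  have "c = (\<Sum>x\<in>s. p x * c)" using assms by (simp add: cell_points_def flip: sum_distrib_right)
  also have "\<dots> \<le> (\<Sum>x\<in>s. p x * f x)"
    using assms by (intro sum_mono mult_left_mono) (auto simp: cell_points_def)
  finally show ?thesis using assms by (simp add: affine_extension_cell)
qed

text \<open>
  The coordinate differences sum to 0, so \<open>f\<close> may be shifted by its midpoint \<open>c\<close>, after which it is bounded by
  \<open>N / 2\<close> on the cell; \<open>seg_length\<close> is half the sum of the absolute differences.
\<close>

lemma affine_extension_Lipschitz_cell:
  assumes p: "p \<in> cell_points {u, v}" and q: "q \<in> cell_points {u, v}" and f: "\<bar>f u - f v\<bar> \<le> N"
  shows "\<bar>affine_extension f p - affine_extension f q\<bar> \<le> N * seg_length p q"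
proof -
  let ?s = "{u, v}"
  define c where "c = (f u + f v) / 2"
  have c: "\<bar>f x - c\<bar> \<le> N / 2" if "x \<in> ?s" for x
    using f that by (auto simp: c_def abs_le_iff field_simps)
  have "(\<Sum>x\<in>?s. (p x - q x) * c) = 0"
    using p q by (simp add: cell_points_def sum_subtractf flip: sum_distrib_right)
  then have "affine_extension f p - affine_extension f q = (\<Sum>x\<in>?s. (p x - q x) * (f x - c))"
    using p q by (simp add: affine_extension_cell[of ?s] right_diff_distrib left_diff_distrib
        sum_subtractf)
  also have "\<bar>\<dots>\<bar> \<le> (\<Sum>x\<in>?s. \<bar>p x - q x\<bar> * (N / 2))"
    unfolding abs_mult[symmetric]
    using c by (intro sum_abs[THEN order_trans] sum_mono) (simp only: abs_mult mult_left_mono abs_ge_zero)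
  also have "\<dots> = N * seg_length p q"
    using seg_length_cell[OF _ p q] by (simp only: sum_distrib_right[symmetric]) simp
  finally show ?thesis .
qed

lemma affine_extension_Lipschitz:
  assumes G: "wf_ugraph G" and "0 \<le> N"
    and f: "\<And>u v. {u, v} \<in> edges G \<Longrightarrow> \<bar>f u - f v\<bar> \<le> N"
  shows "pl_joined G p q l \<Longrightarrow> \<bar>affine_extension f p - affine_extension f q\<bar> \<le> N * l"
proof (induction rule: pl_joined.induct)
  case (step s p p' q l)
  from cell_cases[OF G step.hyps(1)] obtain u v
    where "s = {u, v}" "u = v \<or> {u, v} \<in> edges G" by metis
  with step.hyps(2,3) f \<open>0 \<le> N\<close>
  have "\<bar>affine_extension f p - affine_extension f p'\<bar> \<le> N * seg_length p p'"
    by (intro affine_extension_Lipschitz_cell) auto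
  with step.IH show ?case by (simp add: distrib_left)
qed simp

lemma realization_cases:
  assumes "wf_ugraph G" "p \<in> realization G"
  obtains s v where "s \<in> cells G" "finite s" "p \<in> cell_points s" "v \<in> s" "s \<subseteq> verts G"
proof -
  obtain s where s: "s \<in> cells G" "p \<in> cell_points s"
    using assms(2) by (auto simp: realization_def)
  from cell_cases[OF assms(1) s(1)] obtain u v where "u \<in> verts G" "v \<in> verts G" "s = {u, v}" .
  with s that[of s u] show ?thesis by simp
qed

lemma pl_joined_vertex_cell:
  assumes "wf_ugraph G" "s \<in> cells G" "p \<in> cell_points s" "v \<in> s"
  shows "\<exists>l\<le>1. pl_joined G p (vertex_point v) l" "\<exists>l\<le>1. pl_joined G (vertex_point v) p l"
proof -
  have "finite s" using cell_cases[OF assms(1,2)] by auto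
  with assms show "\<exists>l\<le>1. pl_joined G p (vertex_point v) l" "\<exists>l\<le>1. pl_joined G (vertex_point v) p l"
    by (auto intro!: pl_joined_cell simp: vertex_point_in_cell)
qed

lemma connected_pl_joined_vertices:
  assumes "wf_ugraph G" "connected_ugraph G" "u \<in> verts G" "v \<in> verts G"
  shows "\<exists>l. pl_joined G (vertex_point u) (vertex_point v) l"
  using assms pl_joined_walk[OF assms(1)] unfolding connected_ugraph_def by metis

lemma connected_pl_joined:
  assumes "wf_ugraph G" "connected_ugraph G" "p \<in> realization G" "q \<in> realization G"
  shows "\<exists>l. pl_joined G p q l"
proof -
  obtain s u where s: "s \<in> cells G" "p \<in> cell_points s" "u \<in> s" "s \<subseteq> verts G"
    using realization_cases[OF assms(1,3)] by metis
  obtain t v where t: "t \<in> cells G" "q \<in> cell_points t" "v \<in> t" "t \<subseteq> verts G"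
    using realization_cases[OF assms(1,4)] by metis
  show ?thesis
    using pl_joined_vertex_cell(1)[OF assms(1) s(1-3)] pl_joined_vertex_cell(2)[OF assms(1) t(1-3)]
      connected_pl_joined_vertices[OF assms(1,2), of u v] s t
    by (meson pl_joined_trans subsetD)
qed

text \<open>
  Let \<open>a\<close> and \<open>b\<close> be vertices of the cells of \<open>p\<close> and \<open>q\<close>, let \<open>f\<close> be the distance from \<open>a\<close> in \<open>H\<close>, and
  let \<open>F\<close> be its affine extension to the realization of \<open>G\<close>.  By \<open>fill\<close> the function \<open>F\<close> is
  \<open>N\<close>-Lipschitz along paths in \<open>G\<close>, so \<open>F q - F p\<close> is at most \<open>N\<close> times the distance in \<open>G\<close>.  On the
  other hand \<open>F p \<le> 1\<close> and \<open>F q \<ge> f b - 1\<close>, and the distance in \<open>H\<close> is at most \<open>f b + 2\<close>.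
\<close>

lemma path_metric_subgraph_le:
  assumes G: "wf_ugraph G" and H: "subgraph H G" "connected_ugraph H"
    and verts: "verts H = verts G" and N: "0 < N"
    and fill: "\<And>u v. {u, v} \<in> edges G \<Longrightarrow> \<exists>l\<le>N. pl_joined H (vertex_point u) (vertex_point v) l"
    and p: "p \<in> realization H" and q: "q \<in> realization H"
  shows "path_metric H p q \<le> N * path_metric G p q + 4"
proof -
  have wfH: "wf_ugraph H" using H by (simp add: subgraph_def)
  have cells: "cells H \<subseteq> cells G" using H by (auto simp: subgraph_def cells_def)
  obtain s a where s: "s \<in> cells H" "finite s" "p \<in> cell_points s" "a \<in> s" "s \<subseteq> verts H"
    using realization_cases[OF wfH p] by metis
  obtain t b where t: "t \<in> cells H" "finite t" "q \<in> cell_points t" "b \<in> t" "t \<subseteq> verts H"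
    using realization_cases[OF wfH q] by metis
  define f where "f v = path_metric H (vertex_point a) (vertex_point v)" for v
  have f_step: "f v \<le> f u + c"
    if u: "u \<in> verts H" and uv: "\<exists>l\<le>c. pl_joined H (vertex_point u) (vertex_point v) l" for u v c
  proof -
    obtain l where "pl_joined H (vertex_point a) (vertex_point u) l"
      using connected_pl_joined_vertices[OF wfH H(2), of a u] s u by blast
    moreover obtain m where "m \<le> c" "pl_joined H (vertex_point u) (vertex_point v) m"
      using uv by blast
    ultimately show ?thesis unfolding f_def using path_metric_triangle by (smt (verit))
  qed
  have f_edge: "\<bar>f u - f v\<bar> \<le> N" if "{u, v} \<in> edges G" for u v
  proof -
    have "u \<in> verts H" "v \<in> verts H"
      using G that verts by (auto simp: wf_ugraph_def doubleton_eq_iff)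
    then show ?thesis
      using f_step[of u N v] f_step[of v N u] fill[OF that] fill[of v u] that
      by (auto simp: insert_commute abs_le_iff)
  qed
  let ?F = "affine_extension f"
  have "f x \<le> 1" if "x \<in> s" for x
    using pl_joined_vertex_cell(1)[OF wfH s(1) vertex_point_in_cell[OF s(2,4)] that] path_metric_le
    unfolding f_def by fastforce
  then have Fp: "?F p \<le> 1" using affine_extension_le[OF s(2,3)] by blast
  have "f b - 1 \<le> f y" if "y \<in> t" for y
    using pl_joined_vertex_cell(1)[OF wfH t(1) vertex_point_in_cell[OF t(2) that] t(4)]
      f_step[of y 1 b] t(5) that by auto
  then have Fq: "f b - 1 \<le> ?F q" using affine_extension_ge[OF t(2,3)] by blast
  have "path_metric H p q \<le> f b + 2"
  proof -
    obtain l1 where l1: "l1 \<le> 1" "pl_joined H p (vertex_point a) l1"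
      using pl_joined_vertex_cell(1)[OF wfH s(1,3,4)] by blast
    obtain l2 where l2: "l2 \<le> 1" "pl_joined H (vertex_point b) q l2"
      using pl_joined_vertex_cell(2)[OF wfH t(1,3,4)] by blast
    obtain m where m: "pl_joined H (vertex_point a) (vertex_point b) m"
      using connected_pl_joined_vertices[OF wfH H(2), of a b] s t by blast
    have "path_metric H p q - 2 \<le> f b"
      unfolding f_def
    proof (rule path_metric_greatest[OF m])
      fix l assume "pl_joined H (vertex_point a) (vertex_point b) l"
      then show "path_metric H p q - 2 \<le> l"
        using path_metric_le[OF pl_joined_trans[OF l1(2) pl_joined_trans[OF _ l2(2)]], of l] l1(1) l2(1)
        by linarith
    qed
    then show ?thesis by simp
  qed
  moreover have "?F q - ?F p \<le> N * path_metric G p q"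
  proof -
    obtain l where "pl_joined H p q l" using connected_pl_joined[OF wfH H(2) p q] by blast
    then have "(?F q - ?F p) / N \<le> path_metric G p q"
    proof (rule path_metric_greatest[OF pl_joined_mono[OF cells]])
      fix l assume "pl_joined G p q l"
      then show "(?F q - ?F p) / N \<le> l"
        using affine_extension_Lipschitz[OF G less_imp_le[OF N] f_edge] N by (fastforce simp: field_simps)
    qed
    with N show ?thesis by (simp add: field_simps)
  qed
  ultimately show ?thesis using Fp Fq by linarith
qed

lemma connected_spanning_subgraph:
  assumes "subgraph H G" "verts H = verts G" "connected_ugraph H"
  shows "connected_ugraph G"
proof -
  have "walk H xs \<Longrightarrow> walk G xs" for xs
    using assms(1,2) unfolding walk_def subgraph_def
    by (auto elim!: successively_mono)
  then show ?thesis using assms(2,3) unfolding connected_ugraph_def by metis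
qed

lemma spanning_subgraph_quasi_isometry:
  assumes G: "wf_ugraph G" and H: "subgraph H G" "connected_ugraph H"
    and verts: "verts H = verts G" and N: "1 \<le> N"
    and fill: "\<And>u v. {u, v} \<in> edges G \<Longrightarrow> \<exists>l\<le>N. pl_joined H (vertex_point u) (vertex_point v) l"
  shows "quasi_isometry (realization H) (path_metric H) (realization G) (path_metric G) (\<lambda>p. p)"
proof -
  have wfH: "wf_ugraph H" using H by (simp add: subgraph_def)
  have cells: "cells H \<subseteq> cells G" using H by (auto simp: subgraph_def cells_def)
  have lower: "path_metric H p q / N - 4 \<le> path_metric G p q"
    if "p \<in> realization H" "q \<in> realization H" for p q
  proof -
    have "path_metric H p q \<le> N * path_metric G p q + 4"
      using path_metric_subgraph_le[OF G H verts _ fill that] N by simp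
    also have "\<dots> \<le> N * (path_metric G p q + 4)" using N by (simp add: distrib_left)
    finally show ?thesis using N by (simp add: field_simps)
  qed
  have upper: "path_metric G p q \<le> N * path_metric H p q + 4"
    if pq: "p \<in> realization H" "q \<in> realization H" for p q
  proof -
    obtain l where l: "pl_joined H p q l" using connected_pl_joined[OF wfH H(2) pq] by blast
    have "path_metric G p q \<le> path_metric H p q"
      using path_metric_greatest[OF l path_metric_le[OF pl_joined_mono[OF cells]]] .
    moreover have "0 \<le> path_metric H p q"
      using path_metric_greatest[OF l pl_joined_nonneg] .
    ultimately show ?thesis using N mult_right_mono[of 1 N "path_metric H p q"] by linarith
  qed
  have dense: "\<exists>p\<in>realization H. path_metric G p q \<le> 4" if q: "q \<in> realization G" for q
  proof -
    obtain s v where s: "s \<in> cells G" "q \<in> cell_points s" "v \<in> s" "s \<subseteq> verts G"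
      using realization_cases[OF G q] by metis
    then have "{v} \<in> cells H" using verts by (auto simp: cells_def)
    then have "vertex_point v \<in> realization H"
      unfolding realization_def using vertex_point_in_cell[of "{v}" v] by blast
    moreover have "path_metric G (vertex_point v) q \<le> 4"
      using pl_joined_vertex_cell(2)[OF G s(1-3)] path_metric_le by fastforce
    ultimately show ?thesis by blast
  qed
  show ?thesis
    unfolding quasi_isometry_def
  proof (intro conjI, goal_cases)
    case 1
    show "(\<lambda>p. p) \<in> realization H \<rightarrow> realization G"
      using cells unfolding realization_def by blast
  next
    case 2
    show ?case
      by (rule exI[where x = N], rule exI[where x = 4]) (use N lower upper dense in auto)
  qed
qed

section \<open>Rooted trees given by a parent function\<close>

definition parent_graph :: "'a set \<Rightarrow> 'a \<Rightarrow> ('a \<Rightarrow> 'a) \<Rightarrow> 'a ugraph" where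
  "parent_graph V r p = \<lparr>verts = V, edges = {{x, p x} | x. x \<in> V \<and> x \<noteq> r}\<rparr>"

text \<open>
  The root is its own parent, so that iterating \<open>p\<close> climbs to the root and stays there.  The height strictly decreases
  along parents; it need not be the distance to the root.
\<close>

locale parent_function =
  fixes V :: "'a set" and r :: 'a and p :: "'a \<Rightarrow> 'a" and h :: "'a \<Rightarrow> nat"
  assumes root_in: "r \<in> V" and parent_in: "x \<in> V \<Longrightarrow> p x \<in> V" and parent_root: "p r = r"
    and height_less: "x \<in> V \<Longrightarrow> x \<noteq> r \<Longrightarrow> h (p x) < h x"
begin

abbreviation "T \<equiv> parent_graph V r p"

lemma wf_parent_graph: "wf_ugraph T"
proof -
  have "x \<noteq> p x" if "x \<in> V" "x \<noteq> r" for x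
    using height_less[OF that] by auto
  then show ?thesis
    using parent_in by (fastforce simp: wf_ugraph_def parent_graph_def)
qed

lemma parent_edge: "x \<in> V \<Longrightarrow> x \<noteq> r \<Longrightarrow> {x, p x} \<in> edges T"
  by (auto simp: parent_graph_def)

lemma edge_to_lower:
  assumes "{x, y} \<in> edges T" "h y \<le> h x" shows "y = p x"
  using assms height_less unfolding parent_graph_def
  by (auto simp: doubleton_eq_iff) (metis linorder_not_less)

lemma walk_to_root: "x \<in> V \<Longrightarrow> \<exists>xs. walk T (x # xs) \<and> last (x # xs) = r"
proof (induction "h x" arbitrary: x rule: less_induct)
  case less
  show ?case
  proof (cases "x = r")
    case True
    then show ?thesis using root_in by (intro exI[of _ "[]"]) (simp add: walk_def parent_graph_def)
  next
    case False
    then obtain xs where "walk T (p x # xs)" "last (p x # xs) = r"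
      using less height_less parent_in by blast
    then show ?thesis
      using parent_edge[OF less.prems False] less.prems
      by (intro exI[of _ "p x # xs"]) (auto simp: walk_def parent_graph_def)
  qed
qed

lemma connected_parent_graph: "connected_ugraph T"
  unfolding connected_ugraph_def
proof (intro ballI)
  fix u v assume "u \<in> verts T" "v \<in> verts T"
  then have uv: "u \<in> V" "v \<in> V" by (auto simp: parent_graph_def)
  obtain xs ys where xs: "walk T (u # xs)" "last (u # xs) = r"
    and ys: "walk T (v # ys)" "last (v # ys) = r"
    using walk_to_root uv by meson
  obtain as where as: "u # xs = as @ [r]" using xs(2) by (metis append_butlast_last_id list.distinct(1))
  obtain bs where bs: "v # ys = bs @ [r]" using ys(2) by (metis append_butlast_last_id list.distinct(1))
  have "walk T (r # rev bs)" using walk_rev[OF ys(1)] bs by simp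
  with xs(1) as have "walk T (as @ r # rev bs)" by (simp add: walk_append)
  moreover have "hd (as @ r # rev bs) = u" using as by (metis hd_append list.sel(1) list.distinct(1))
  moreover have "last (as @ r # rev bs) = v" using bs by (cases bs) auto
  ultimately show "\<exists>xs. walk T xs \<and> hd xs = u \<and> last xs = v" by blast
qed

text \<open>
  At a vertex of maximal height on a cycle both neighbours in the cycle would have to be its parent.
\<close>

lemma acyclic_parent_graph: "\<not> cycle T xs"
proof
  assume "cycle T xs"
  then have xs: "distinct xs" "3 \<le> length xs" "{last xs, hd xs} \<in> edges T"
    and succ: "\<And>i. Suc i < length xs \<Longrightarrow> {xs ! i, xs ! Suc i} \<in> edges T"
    by (auto simp: cycle_def walk_def successively_conv_nth)
  let ?n = "length xs"
  have "xs \<noteq> []" using xs(2) by auto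
  then have "Max (h ` set xs) \<in> h ` set xs" by (intro Max_in) auto
  then obtain x where "x \<in> set xs" and "h x = Max (h ` set xs)" by auto
  then have max: "h y \<le> h x" if "y \<in> set xs" for y
    using that by simp
  obtain i where i: "i < ?n" "x = xs ! i" using \<open>x \<in> set xs\<close> by (metis in_set_conv_nth)
  (* the cyclic neighbours of position i *)
  define j where "j = (if i = 0 then ?n - 1 else i - 1)"
  define k where "k = (if i = ?n - 1 then 0 else i + 1)"
  have jk: "j < ?n" "k < ?n" "j \<noteq> k" using i xs(2) by (auto simp: j_def k_def)
  have wrap: "{xs ! (?n - 1), xs ! 0} \<in> edges T"
    using xs(3) \<open>xs \<noteq> []\<close> by (simp add: hd_conv_nth last_conv_nth)
  have "{xs ! i, xs ! j} \<in> edges T"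
    using wrap succ[of "i - 1"] i by (auto simp: j_def insert_commute)
  then have "xs ! j = p x" using edge_to_lower max jk i by auto
  moreover have "{xs ! i, xs ! k} \<in> edges T"
    using wrap succ[of i] i by (auto simp: k_def insert_commute)
  then have "xs ! k = p x" using edge_to_lower max jk i by auto
  ultimately show False using xs(1) jk nth_eq_iff_index_eq by metis
qed

lemma tree_parent_graph: "tree T"
  unfolding tree_def
  using wf_parent_graph connected_parent_graph acyclic_parent_graph root_in
  by (auto simp: parent_graph_def)

lemma iterate_parent_in: "x \<in> V \<Longrightarrow> (p ^^ i) x \<in> V"
  by (induction i) (auto simp: parent_in)

lemma iterate_parent_root: "(p ^^ i) r = r"
  by (induction i) (auto simp: parent_root)

lemma iterate_parent_height: "x \<in> V \<Longrightarrow> x \<noteq> r \<Longrightarrow> 0 < i \<Longrightarrow> h ((p ^^ i) x) < h x"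
proof (induction i)
  case (Suc i)
  consider "i = 0" | "0 < i" "(p ^^ i) x = r" | "0 < i" "(p ^^ i) x \<noteq> r" by blast
  then show ?case
  proof cases
    case 1
    then show ?thesis using Suc.prems height_less by simp
  next
    case 2
    then show ?thesis using Suc.IH[OF Suc.prems(1,2)] by (simp add: parent_root)
  next
    case 3
    then show ?thesis
      using Suc.IH[OF Suc.prems(1,2)] height_less[of "(p ^^ i) x"] iterate_parent_in[OF Suc.prems(1), of i]
      by simp
  qed
qed simp

text \<open>
  If \<open>k\<close> and \<open>l\<close> are both large, then each of the two ancestors \<open>p\<^sup>i x\<close> and \<open>p\<^sup>j z\<close> is a proper iterated parent of the
  other, which the height permits for the root only; so both are the root.
\<close>

lemma common_ancestor:
  assumes x: "x \<in> V" and i: "i \<le> n" "(p ^^ i) x = (p ^^ k) z"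
    and j: "j \<le> n" "(p ^^ j) z = (p ^^ l) x"
  shows "\<exists>a\<le>n. \<exists>b\<le>n. (p ^^ a) x = (p ^^ b) z"
proof (cases "k \<le> n \<or> l \<le> n")
  case True
  then show ?thesis using i j by metis
next
  case False
  with i j have less: "j < k" "i < l" by auto
  let ?m = "(p ^^ i) x"
  have "?m = (p ^^ (k - j)) ((p ^^ j) z)"
    using i(2) less by (metis comp_apply funpow_add le_add_diff_inverse2 less_imp_le)
  also have "(p ^^ j) z = (p ^^ (l - i)) ?m"
    using j(2) less by (metis comp_apply funpow_add le_add_diff_inverse2 less_imp_le)
  finally have fix_m: "(p ^^ (k - j + (l - i))) ?m = ?m" unfolding funpow_add o_apply by (rule sym)
  have "?m = r"
  proof (rule ccontr)
    assume "?m \<noteq> r"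
    then have "h ((p ^^ (k - j + (l - i))) ?m) < h ?m"
      using less x by (intro iterate_parent_height iterate_parent_in) auto
    with fix_m show False by simp
  qed
  moreover have "(p ^^ j) z = (p ^^ (l - i)) ?m" by fact
  ultimately have "(p ^^ j) z = ?m" by (simp add: iterate_parent_root)
  then show ?thesis using i j by metis
qed

lemma pl_joined_parent:
  assumes "x \<in> V"
  shows "\<exists>l\<le>1. pl_joined T (vertex_point x) (vertex_point (p x)) l"
    and "\<exists>l\<le>1. pl_joined T (vertex_point (p x)) (vertex_point x) l"
proof -
  have "{x, p x} \<in> cells T"
    using assms parent_root root_in by (cases "x = r") (auto simp: cells_def parent_graph_def)
  then show "\<exists>l\<le>1. pl_joined T (vertex_point x) (vertex_point (p x)) l"
    and "\<exists>l\<le>1. pl_joined T (vertex_point (p x)) (vertex_point x) l"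
    by (auto intro!: pl_joined_vertex_cell(1)[OF wf_parent_graph] vertex_point_in_cell)
qed

lemma pl_joined_iterate_parent:
  assumes "x \<in> V"
  shows "\<exists>l\<le>real i. pl_joined T (vertex_point x) (vertex_point ((p ^^ i) x)) l"
    and "\<exists>l\<le>real i. pl_joined T (vertex_point ((p ^^ i) x)) (vertex_point x) l"
proof (induction i)
  case 0
  have "vertex_point x \<in> realization T"
    using assms vertex_point_in_cell[of "{x}" x]
    by (auto simp: realization_def cells_def parent_graph_def)
  then have "pl_joined T (vertex_point x) (vertex_point x) 0" by (rule pl_joined.refl)
  then show "\<exists>l\<le>real 0. pl_joined T (vertex_point x) (vertex_point ((p ^^ 0) x)) l"
    and "\<exists>l\<le>real 0. pl_joined T (vertex_point ((p ^^ 0) x)) (vertex_point x) l" by auto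
next
  case (Suc i)
  let ?y = "(p ^^ i) x"
  have y: "?y \<in> V" using assms by (rule iterate_parent_in)
  obtain l m l' m' where
    "l \<le> real i" "pl_joined T (vertex_point x) (vertex_point ?y) l"
    "m \<le> 1" "pl_joined T (vertex_point ?y) (vertex_point (p ?y)) m"
    "l' \<le> real i" "pl_joined T (vertex_point ?y) (vertex_point x) l'"
    "m' \<le> 1" "pl_joined T (vertex_point (p ?y)) (vertex_point ?y) m'"
    using Suc pl_joined_parent[OF y] by blast
  then have "l + m \<le> real (Suc i)" "pl_joined T (vertex_point x) (vertex_point (p ?y)) (l + m)"
    "m' + l' \<le> real (Suc i)" "pl_joined T (vertex_point (p ?y)) (vertex_point x) (m' + l')"
    by (auto intro: pl_joined_trans)
  then show "\<exists>l\<le>real (Suc i). pl_joined T (vertex_point x) (vertex_point ((p ^^ Suc i) x)) l"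
    and "\<exists>l\<le>real (Suc i). pl_joined T (vertex_point ((p ^^ Suc i) x)) (vertex_point x) l"
    by (metis funpow.simps(2) o_apply)+
qed

lemma pl_joined_common_ancestor:
  assumes "x \<in> V" "z \<in> V" "a \<le> n" "b \<le> n" "(p ^^ a) x = (p ^^ b) z"
  shows "\<exists>l\<le>2 * real n. pl_joined T (vertex_point x) (vertex_point z) l"
proof -
  obtain l m where "l \<le> real a" "pl_joined T (vertex_point x) (vertex_point ((p ^^ a) x)) l"
    "m \<le> real b" "pl_joined T (vertex_point ((p ^^ a) x)) (vertex_point z) m"
    using pl_joined_iterate_parent(1)[OF assms(1), of a]
      pl_joined_iterate_parent(2)[OF assms(2), of b] assms(5) by auto
  moreover have "l + m \<le> 2 * real n" using calculation assms(3,4) by simp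
  ultimately show ?thesis by (meson pl_joined_trans)
qed

end

section \<open>The betweenness order seen from a base point\<close>

lemma mdiam_union_triangle:
  assumes "A \<subseteq> mspace m" "B \<subseteq> mspace m" "D \<subseteq> mspace m" "B \<noteq> {}"
  shows "mdiam m (A \<union> D) \<le> mdiam m (A \<union> B) + mdiam m (B \<union> D)"
  unfolding mdiam_def[of m "A \<union> D"]
proof (intro SUP_least)
  have le: "ennreal (mdist m x y) \<le> mdiam m S" if "x \<in> S" "y \<in> S" for x y S
    unfolding mdiam_def using that by (meson SUP_upper2 order_refl)
  obtain b where b: "b \<in> B" using assms(4) by blast
  fix x y assume xy: "x \<in> A \<union> D" "y \<in> A \<union> D"
  have "mdist m x y \<le> mdist m x b + mdist m b y"
    using xy b assms by (intro mdist_triangle) auto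
  then have tri: "ennreal (mdist m x y) \<le> ennreal (mdist m x b) + ennreal (mdist m b y)"
    by (simp add: ennreal_leI flip: ennreal_plus)
  consider "x \<in> A" "y \<in> A" | "x \<in> D" "y \<in> D" | "x \<in> A" "y \<in> D" | "x \<in> D" "y \<in> A"
    using xy by blast
  then show "ennreal (mdist m x y) \<le> mdiam m (A \<union> B) + mdiam m (B \<union> D)"
  proof cases
    case 1 then show ?thesis using le[of x "A \<union> B" y] by (simp add: add_increasing2)
  next
    case 2 then show ?thesis using le[of x "B \<union> D" y] by (simp add: add_increasing)
  next
    case 3 then show ?thesis
      using add_mono[OF le[of x "A \<union> B" b] le[of b "B \<union> D" y]] b tri by fastforce
  next
    case 4 then show ?thesis
      using add_mono[OF le[of b "A \<union> B" y] le[of x "B \<union> D" b]] b tri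
      by (fastforce simp: add.commute)
  qed
qed

locale based_projections = strong_projections +
  fixes K :: real and R :: 'a
  assumes K: "2 * \<theta> \<le> K" and base: "R \<in> \<Y>"
begin

abbreviation d :: "'a \<Rightarrow> 'a \<Rightarrow> 'a \<Rightarrow> ennreal" where
  "d \<equiv> proj_dist C \<pi>"

abbreviation far :: "'a \<Rightarrow> 'a \<Rightarrow> 'a set" where
  "far \<equiv> proj_far \<Y> C \<pi> K"

lemma theta_le_K: "ennreal \<theta> \<le> ennreal K"
  using K theta_nonneg by (intro ennreal_leI) linarith

lemma d_commute: "d Y X Z = d Y Z X"
  by (simp add: proj_dist_def Un_commute)

lemma far_commute: "far X Z = far Z X"
  by (auto simp: proj_far_def d_commute)

lemma farI: "\<lbrakk>Y \<in> \<Y>; Y \<noteq> X; Y \<noteq> Z; d Y X Z > ennreal K\<rbrakk> \<Longrightarrow> Y \<in> far X Z"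
  by (simp add: proj_far_def)

lemma farD:
  assumes "Y \<in> far X Z"
  shows "Y \<in> \<Y>" "Y \<noteq> X" "Y \<noteq> Z" "d Y X Z > ennreal K" "d Y X Z > ennreal \<theta>"
  using assms theta_le_K by (auto simp: proj_far_def)

lemma d_self: "\<lbrakk>X \<in> \<Y>; Y \<in> \<Y>; X \<noteq> Y\<rbrakk> \<Longrightarrow> d Y X X \<le> ennreal \<theta>"
  using P3 by (simp add: proj_dist_def)

lemma d_cong: "\<pi> Y X = \<pi> Y X' \<Longrightarrow> d Y X Z = d Y X' Z"
  by (simp add: proj_dist_def)

text \<open>
  The threshold \<open>K\<close> is at least \<open>2 * \<theta>\<close>, so by the triangle inequality a pair that is \<open>K\<close>-far in \<open>C Y\<close> cannot be
  \<open>\<theta>\<close>-close to one common point.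
\<close>

lemma d_split:
  assumes "Y \<in> \<Y>" "X \<in> \<Y>" "W \<in> \<Y>" "Z \<in> \<Y>" "X \<noteq> Y" "W \<noteq> Y" "Z \<noteq> Y" "d Y X Z > ennreal K"
  shows "d Y X W > ennreal \<theta> \<or> d Y W Z > ennreal \<theta>"
proof (rule ccontr)
  assume "\<not> ?thesis"
  then have "d Y X W + d Y W Z \<le> ennreal \<theta> + ennreal \<theta>" by (auto simp: not_less intro: add_mono)
  moreover have "d Y X Z \<le> d Y X W + d Y W Z"
    unfolding proj_dist_def using assms proj_subset proj_nonempty
    by (intro mdiam_union_triangle) auto
  moreover have "ennreal \<theta> + ennreal \<theta> \<le> ennreal K"
    using K theta_nonneg by (simp add: ennreal_leI flip: ennreal_plus)
  ultimately show False using assms(8) by (meson leD order_trans)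
qed

lemma far_same: assumes "X \<in> \<Y>" shows "far X X = {}"
  using d_self[OF assms] theta_le_K by (fastforce simp: proj_far_def)

lemma finite_far: assumes "X \<in> \<Y>" "Z \<in> \<Y>" shows "finite (far X Z)"
  by (rule finite_subset[OF _ P5[OF assms]]) (use theta_le_K in \<open>auto simp: proj_far_def\<close>)

text \<open>
  Since \<open>R\<close> and \<open>X\<close> are far apart in \<open>C W\<close>, axiom (P4') lets \<open>X\<close> see \<open>W\<close> and \<open>R\<close> in the same place.  All
  betweenness arguments below transport distances along such equalities of projections.
\<close>

lemma far_base_proj_eq:
  assumes "X \<in> \<Y>" "W \<in> far R X" shows "\<pi> X W = \<pi> X R"
proof -
  have "X \<noteq> R" using far_same[OF base] assms by auto
  then show ?thesis using assms farD[OF assms(2)] base P4'[of X W R] d_commute by auto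
qed

lemma far_base_asym:
  assumes "X \<in> \<Y>" "W \<in> far R X" shows "X \<notin> far R W"
proof
  assume "X \<in> far R W"
  then have "d X R R > ennreal \<theta>"
    using far_base_proj_eq[OF assms] farD(5) d_cong d_commute by metis
  then show False using d_self[of R X] assms(1) base farD(2)[OF \<open>X \<in> far R W\<close>] by (auto simp: not_less)
qed

text \<open>
  If \<open>W\<close>, \<open>Y\<close>, \<open>X\<close> follow each other as seen from the base point, then \<open>W\<close> looks from \<open>Y\<close>
  like the base point; hence \<open>Y\<close> also separates \<open>W\<close> from \<open>X\<close>, and by (P4') in turn
  \<open>Y\<close> and \<open>X\<close> look the same from \<open>W\<close>.
\<close>

lemma far_between:
  assumes "X \<in> \<Y>" "Y \<in> far R X" "W \<in> far R Y"
  shows "d Y W X > ennreal K" "\<pi> W Y = \<pi> W X" "W \<noteq> X"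
proof -
  note Y = farD[OF assms(2)] and W = farD[OF assms(3)]
  show "W \<noteq> X" using far_base_asym[OF assms(1,2)] assms(3) by auto
  show d: "d Y W X > ennreal K"
    using d_cong[OF far_base_proj_eq[OF Y(1) assms(3)]] Y(4) by simp
  show "\<pi> W Y = \<pi> W X"
    using d \<open>W \<noteq> X\<close> Y W assms(1) theta_le_K by (intro P4') auto
qed

lemma far_base_trans:
  assumes "X \<in> \<Y>" "Y \<in> far R X" "W \<in> far R Y" shows "W \<in> far R X"
  using farD[OF assms(3)] far_between[OF assms] d_cong d_commute by (intro farI) metis+

text \<open>
  In \<open>C W\<close> the projection of \<open>Y\<close> is far from that of \<open>R\<close> or from that of \<open>X\<close>.  If it is far from that of \<open>X\<close>, then
  \<open>W\<close> and \<open>X\<close> look the same from \<open>Y\<close>, so \<open>Y\<close> separates \<open>R\<close> from \<open>W\<close>.  If it is far from that of \<open>R\<close>, then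
  \<open>W\<close> and \<open>R\<close> look the same from \<open>Y\<close>, whence \<open>Y\<close> and \<open>X\<close> look the same from \<open>W\<close>, and \<open>W\<close> separates
  \<open>R\<close> from \<open>Y\<close>.
\<close>

lemma far_base_total:
  assumes X: "X \<in> \<Y>" and W: "W \<in> far R X" and Y: "Y \<in> far R X" and ne: "W \<noteq> Y"
  shows "W \<in> far R Y \<or> Y \<in> far R W"
proof -
  note W' = farD[OF W] and Y' = farD[OF Y]
  have "d W R Y > ennreal \<theta> \<or> d W Y X > ennreal \<theta>"
    using W' Y' X base ne by (intro d_split) auto
  then show ?thesis
  proof
    assume "d W Y X > ennreal \<theta>"
    then have "\<pi> Y W = \<pi> Y X" using W' Y' X ne by (intro P4') auto
    then have "d Y R W > ennreal K" using Y'(4) by (metis d_cong d_commute)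
    then show ?thesis using Y' ne by (auto intro: farI)
  next
    assume a: "d W R Y > ennreal \<theta>"
    have "\<pi> Y W = \<pi> Y R" using a W' Y' base ne by (intro P4') (auto simp: d_commute)
    then have "d Y W X > ennreal \<theta>" using Y'(5) by (metis d_cong)
    then have "\<pi> W Y = \<pi> W X" using W' Y' X ne by (intro P4') auto
    then have "d W R Y > ennreal K" using W'(4) by (metis d_cong d_commute)
    then show ?thesis using W' ne by (auto intro: farI)
  qed
qed

section \<open>The tree of nearest predecessors\<close>

definition parent :: "'a \<Rightarrow> 'a" where
  "parent X = (if far R X = {} then R else SOME Y. Y \<in> far R X \<and> far R X = insert Y (far R Y))"

text \<open>
  The successor puts points without predecessors strictly above the base point, their parent.
\<close>

definition height :: "'a \<Rightarrow> nat" where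
  "height X = (if X = R then 0 else Suc (card (far R X)))"

lemma card_far_less:
  assumes "X \<in> \<Y>" "Y \<in> far R X" shows "card (far R Y) < card (far R X)"
proof (rule psubset_card_mono)
  show "finite (far R X)" using finite_far base assms by blast
  show "far R Y \<subset> far R X" using far_base_trans[OF assms] farD(3)[of Y R Y] assms(2) by blast
qed

text \<open>
  A predecessor with the most predecessors of its own is the last one, since the predecessors form a chain.
\<close>

lemma last_predecessor:
  assumes X: "X \<in> \<Y>" and ne: "far R X \<noteq> {}"
  shows "\<exists>Y. Y \<in> far R X \<and> far R X = insert Y (far R Y)"
proof -
  have fin: "finite ((\<lambda>Y. card (far R Y)) ` far R X)" using finite_far[OF base X] by simp
  then have "Max ((\<lambda>Y. card (far R Y)) ` far R X) \<in> (\<lambda>Y. card (far R Y)) ` far R X"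
    using ne by (intro Max_in) auto
  then obtain Y where Y: "Y \<in> far R X"
    and "card (far R Y) = Max ((\<lambda>Y. card (far R Y)) ` far R X)" by auto
  then have max: "card (far R Z) \<le> card (far R Y)" if "Z \<in> far R X" for Z
    using Max_ge[OF fin] that by auto
  have "Z \<in> far R Y" if "Z \<in> far R X" "Z \<noteq> Y" for Z
    using far_base_total[OF X that(1) Y that(2)] card_far_less[of Z Y] farD(1)[OF that(1)] max[OF that(1)]
    by fastforce
  then have "far R X = insert Y (far R Y)" using far_base_trans[OF X Y] Y by auto
  with Y show ?thesis by blast
qed

lemma parent_eq_base: "far R X = {} \<Longrightarrow> parent X = R"
  by (simp add: parent_def)

lemma parent_far:
  assumes "X \<in> \<Y>" "far R X \<noteq> {}"
  shows "parent X \<in> far R X" "far R X = insert (parent X) (far R (parent X))"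
  using someI_ex[OF last_predecessor[OF assms]] assms(2) by (simp_all add: parent_def)

lemma parent_in: "X \<in> \<Y> \<Longrightarrow> parent X \<in> \<Y>"
  using parent_far(1) farD(1) parent_eq_base base by metis

sublocale parent_function \<Y> R parent height
proof
  show "parent R = R" by (simp add: parent_eq_base far_same base)
next
  fix X assume X: "X \<in> \<Y>" "X \<noteq> R"
  then show "height (parent X) < height X"
    using parent_far(1)[OF X(1)] card_far_less[OF X(1)] parent_eq_base[of X]
    by (cases "far R X = {}") (auto simp: height_def)
qed (use base parent_in in auto)

lemma predecessors_are_iterates:
  assumes "X \<in> \<Y>" "W \<in> insert R (insert X (far R X))"
  shows "\<exists>k. (parent ^^ k) X = W"
  using assms
proof (induction "card (far R X)" arbitrary: X rule: less_induct)
  case less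
  consider "W = X" | "far R X = {}" "W = R" | "far R X \<noteq> {}" "W \<noteq> X"
    using less.prems(2) by blast
  then show ?case
  proof cases
    case 1
    then show ?thesis by (intro exI[of _ 0]) simp
  next
    case 2
    then show ?thesis by (intro exI[of _ 1]) (simp add: parent_eq_base)
  next
    case 3
    note P = parent_far[OF less.prems(1) 3(1)]
    have "W \<in> insert R (insert (parent X) (far R (parent X)))"
      using less.prems(2) 3(2) P(2) by blast
    then obtain k where "(parent ^^ k) (parent X) = W"
      using less.hyps[OF card_far_less[OF less.prems(1) P(1)] parent_in[OF less.prems(1)]] by blast
    then show ?thesis by (intro exI[of _ "Suc k"]) (simp add: funpow_Suc_right del: funpow.simps)
  qed
qed

text \<open>
  A point \<open>W\<close> separating \<open>X\<close> from its parent \<open>Q\<close> would lie between \<open>Q\<close> and \<open>X\<close> also as seen from the base point, but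
  \<open>Q\<close> is the last predecessor of \<open>X\<close>.
\<close>

lemma far_parent_empty:
  assumes X: "X \<in> \<Y>" shows "far (parent X) X = {}"
proof (cases "far R X = {}")
  case True
  then show ?thesis by (simp add: parent_eq_base)
next
  case False
  define Q where "Q = parent X"
  note Q_far = parent_far[OF X False, folded Q_def]
  note Q = farD[OF Q_far(1)]
  have "W \<notin> far Q X" for W
  proof
    assume "W \<in> far Q X"
    note W = farD[OF this]
    have eq: "\<pi> Q W = \<pi> Q X" using W Q X by (intro P4') auto
    have "W \<noteq> R"
    proof
      assume "W = R"
      then have "d Q R X = d Q R R" using eq by (metis d_cong d_commute)
      then show False using Q base d_self[of R Q] by (auto simp: not_less)
    qed
    have "d Q R W > ennreal K" using eq Q(4) by (metis d_cong d_commute)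
    then have QW: "Q \<in> far R W" using Q W by (auto intro: farI)
    have "d W R X > ennreal K" using far_base_proj_eq[OF W(1) QW] W(4) by (metis d_cong)
    then have "W \<in> far R X" using W \<open>W \<noteq> R\<close> by (auto intro: farI)
    then have "W \<in> far R Q" using Q_far(2) W(2) by blast
    then show False using far_base_asym[OF W(1) QW] by blast
  qed
  then show ?thesis by (auto simp: Q_def)
qed

text \<open>
  The points \<open>R\<close> and \<open>X\<close> are far apart in the middle space \<open>C W2\<close>, so \<open>Z\<close> is far from one of them
  there.  If it is far from \<open>R\<close>, then \<open>W1\<close> sees \<open>Z\<close> in the same place as \<open>W2\<close> and so as \<open>X\<close>; if it is far
  from \<open>X\<close>, then \<open>W3\<close> sees \<open>Z\<close> in the same place as \<open>W2\<close> and so as \<open>R\<close>.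
\<close>

lemma no_three_predecessors:
  assumes X: "X \<in> \<Y>" and Z: "Z \<in> \<Y>" and adj: "far X Z = {}"
    and W1: "W1 \<in> far R W2" and W2: "W2 \<in> far R W3" and W3: "W3 \<in> far R X"
    and Z_ne: "Z \<noteq> X" "Z \<noteq> W1" "Z \<noteq> W2" "Z \<noteq> W3" and W1Z: "W1 \<notin> far R Z"
  shows False
proof -
  have W2X: "W2 \<in> far R X" using far_base_trans[OF X W3 W2] .
  have W1X: "W1 \<in> far R X" using far_base_trans[OF X W2X W1] .
  note w1 = farD[OF W1] farD[OF W1X] and w2 = farD[OF W2] farD[OF W2X] and w3 = farD[OF W3]
  consider "d W2 R Z > ennreal \<theta>" | "d W2 Z X > ennreal \<theta>"
    using d_split[of W2 R Z X] w2 base Z X Z_ne by auto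
  then show False
  proof cases
    case 1
    have "d W2 W1 Z > ennreal \<theta>"
      using 1 d_cong[OF far_base_proj_eq[OF w2(1) W1]] by simp
    then have "\<pi> W1 W2 = \<pi> W1 Z" using w1 w2 Z Z_ne by (intro P4') auto
    then have "\<pi> W1 Z = \<pi> W1 X" using far_between(2)[OF X W2X W1] by simp
    then have "d W1 R Z > ennreal K" using w1(9) by (metis d_cong d_commute)
    then show False using W1Z w1 Z_ne by (auto intro: farI)
  next
    case 2
    have "d W2 W3 Z > ennreal \<theta>"
      using 2 d_cong[OF far_between(2)[OF X W3 W2], of Z] by (simp add: d_commute)
    then have "\<pi> W3 W2 = \<pi> W3 Z" using w2 w3 Z Z_ne by (intro P4') auto
    then have "\<pi> W3 Z = \<pi> W3 R" using far_base_proj_eq[OF w3(1) W2] by simp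
    then have "d W3 X Z > ennreal K" using w3(4) by (metis d_cong d_commute)
    then have "W3 \<in> far X Z" using w3 Z_ne by (auto intro: farI)
    then show False using adj by blast
  qed
qed

text \<open>
  Otherwise the first three iterated parents of \<open>X\<close> would be three predecessors of the kind just excluded.
\<close>

lemma adjacent_iterate_parent:
  assumes X: "X \<in> \<Y>" and Z: "Z \<in> \<Y>" and adj: "far X Z = {}"
  shows "\<exists>i\<le>3. \<exists>k. (parent ^^ i) X = (parent ^^ k) Z"
proof (rule ccontr)
  assume neg: "\<not> ?thesis"
  have not_pred: "(parent ^^ i) X \<notin> insert R (insert Z (far R Z))" if "i \<le> 3" for i
    using neg that predecessors_are_iterates[OF Z] by metis
  have up: "(parent ^^ Suc i) X \<in> far R ((parent ^^ i) X)" if "Suc i \<le> 3" for i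
    using not_pred[OF that] parent_far(1)[OF iterate_parent_in[OF X]] parent_eq_base
    by (metis funpow.simps(2) insertI1 o_apply)
  have "(parent ^^ 1) X \<in> far R X" "(parent ^^ 2) X \<in> far R ((parent ^^ 1) X)"
    "(parent ^^ 3) X \<in> far R ((parent ^^ 2) X)"
    using up[of 0] up[of 1] up[of 2] by (simp_all add: numeral_2_eq_2 numeral_3_eq_3)
  then show False
    using no_three_predecessors[OF X Z adj, of "(parent ^^ 3) X" "(parent ^^ 2) X" "(parent ^^ 1) X"]
      not_pred[of 0] not_pred[of 1] not_pred[of 2] not_pred[of 3] by auto
qed

lemma adjacent_common_ancestor:
  assumes "X \<in> \<Y>" "Z \<in> \<Y>" "far X Z = {}"
  shows "\<exists>a\<le>3. \<exists>b\<le>3. (parent ^^ a) X = (parent ^^ b) Z"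
  using adjacent_iterate_parent[OF assms] adjacent_iterate_parent[of Z X] assms far_commute
    common_ancestor[OF assms(1), of _ 3 _ Z] by metis

abbreviation "P \<equiv> proj_complex \<Y> C \<pi> K"

lemma wf_proj_complex: "wf_ugraph P"
  by (auto simp: wf_ugraph_def proj_complex_def)

lemma tree_subgraph_proj_complex: "subgraph T P"
  unfolding subgraph_def
proof (intro conjI wf_parent_graph)
  show "edges T \<subseteq> edges P"
  proof
    fix e assume "e \<in> edges T"
    then obtain X where "e = {X, parent X}" "X \<in> \<Y>" "X \<noteq> R" by (auto simp: parent_graph_def)
    moreover from this have "parent X \<noteq> X" using height_less by fastforce
    ultimately show "e \<in> edges P"
      using far_parent_empty[of X] far_commute[of X] parent_in[of X]
      unfolding proj_complex_def by (simp, metis)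
  qed
qed (simp add: parent_graph_def proj_complex_def)

lemma pl_joined_adjacent:
  assumes "{u, v} \<in> edges P"
  shows "\<exists>l\<le>6. pl_joined T (vertex_point u) (vertex_point v) l"
proof -
  have uv: "u \<in> \<Y>" "v \<in> \<Y>" "far u v = {}"
    using assms far_commute by (auto simp: proj_complex_def doubleton_eq_iff)
  then show ?thesis
    using adjacent_common_ancestor[OF uv] pl_joined_common_ancestor[of u v _ 3] by auto
qed

lemma tree_quasi_isometry:
  "quasi_isometry (realization T) (path_metric T) (realization P) (path_metric P) (\<lambda>p. p)"
  using wf_proj_complex tree_subgraph_proj_complex connected_parent_graph _ _ pl_joined_adjacent
  by (rule spanning_subgraph_quasi_isometry) (simp_all add: parent_graph_def proj_complex_def)

end

theorem theorem1p1:
  fixes \<Y> :: "'a set" and C :: "'a \<Rightarrow> 'b metric" and \<pi> :: "'a \<Rightarrow> 'a \<Rightarrow> 'b set"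
    and \<theta> K :: real
  assumes "\<Y> \<noteq> {}"
    and "strong_projections \<Y> C \<pi> \<theta>"
    and "K \<ge> 4 * \<theta>"
  shows "connected_ugraph (proj_complex \<Y> C \<pi> K) \<and>
    (\<exists>T. subgraph T (proj_complex \<Y> C \<pi> K) \<and> tree T \<and>
      quasi_isometry (realization T) (path_metric T)
        (realization (proj_complex \<Y> C \<pi> K)) (path_metric (proj_complex \<Y> C \<pi> K)) (\<lambda>p. p))"
proof -
  obtain R where R: "R \<in> \<Y>" using assms(1) by blast
  interpret strong_projections \<Y> C \<pi> \<theta> by fact
  interpret based_projections \<Y> C \<pi> \<theta> K R
    using assms(3) theta_nonneg R by unfold_locales auto
  have "verts T = verts P" by (simp add: parent_graph_def proj_complex_def)
  then show ?thesis
    using tree_subgraph_proj_complex tree_parent_graph tree_quasi_isometry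
      connected_parent_graph connected_spanning_subgraph by blast
qed

end
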